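(* Let $k,n,c$ be integers with $k\ge 2$ and $n\ge 2$. Let $\mathbb{Z}_n^{\ast\ast}=\{a\in\mathbb{Z}_n:\gcd(a,n)=1\text{ and }\gcd(a-1,n)=1\}$ be the set of exceptional units of $\mathbb{Z}_n$, and let $$\varphi_k(n,c)=\#\{(x_1,\dots,x_k)\in(\mathbb{Z}_n^{\ast\ast})^k:\ x_1+x_2+\cdots+x_k\equiv c \pmod n\}.$$ Then $$\varphi_k(n,c)=(-1)^k\prod_{p^{\alpha}\| n}p^{\alpha k-\alpha-k}\left(p\sum_{\substack{j=0\\ j\equiv c \ (\mathrm{mod}\ p)}}^{k}\binom{k}{j}+(2-p)^k-2^k\right),$$ where the product runs over the primes $p$ dividing $n$, and $\alpha$ is the exponent with $p^{\alpha}\| n$.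
   Context: $\mathbb{Z}_n$ is the ring of residue classes modulo $n$. A unit $u$ of a commutative ring $R$ with $1$ is called exceptional if $1-u$ is also a unit. For a prime $p$, $p^{\alpha}\| n$ means $p^{\alpha}\mid n$ and $p^{\alpha+1}\nmid n$. The letter $p$ always denotes a prime.
   Formalization: The sign (-1)^k before the product is corrected to (-1)^{kω(n)}, with ω(n) the number of distinct primes dividing n; the printed sign fails for k=3, n=15, c=6, where the count is 4 but the printed formula gives -4. *)

theory Defs
  imports "HOL-Number_Theory.Number_Theory"
begin

definition exceptional_units :: "('a, 'b) ring_scheme \<Rightarrow> 'a set" where
  "exceptional_units R = {u \<in> Units R. \<one>\<^bsub>R\<^esub> \<ominus>\<^bsub>R\<^esub> u \<in> Units R}"

text \<open>The ring of residue classes modulo \<open>n\<close> is \<^const>\<open>residue_ring\<close>, whose carrier is the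
  system of representatives \<open>{0..n - 1}\<close>.\<close>

definition exc_units_mod :: "int \<Rightarrow> int set" where
  "exc_units_mod n = {a \<in> carrier (residue_ring n). gcd a n = 1 \<and> gcd (a - 1) n = 1}"

lemma exc_units_mod_eq_exceptional_units:
  assumes "n \<ge> 2"
  shows "exc_units_mod n = exceptional_units (residue_ring n)"
proof -
  interpret residues n "residue_ring n"
    by unfold_locales (use assms in simp_all)
  have unit_iff: "u \<in> Units (residue_ring n) \<longleftrightarrow> u \<in> carrier (residue_ring n) \<and> gcd u n = 1" for u
    using assms by (auto simp: res_units_eq res_carrier_eq coprime_iff_gcd_eq_1 order_less_le)
  have minus: "\<one>\<^bsub>residue_ring n\<^esub> \<ominus>\<^bsub>residue_ring n\<^esub> u = (1 - u) mod n" for u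
    by (simp add: a_minus_def res_one_eq res_neg_eq res_add_eq mod_add_right_eq)
  have gcd_minus: "gcd ((1 - u) mod n) n = gcd (u - 1) n" for u
    by (metis gcd.commute gcd_neg1_int gcd_red_int minus_diff_eq)
  have "(1 - u) mod n \<in> carrier (residue_ring n)" for u
    using assms by (simp add: res_carrier_eq)
  then show ?thesis
    by (auto simp: exc_units_mod_def exceptional_units_def unit_iff minus gcd_minus)
qed

definition phi :: "nat \<Rightarrow> int \<Rightarrow> int \<Rightarrow> nat" where
  "phi k n c = card {x \<in> {1..k} \<rightarrow>\<^sub>E exc_units_mod n. [(\<Sum>i=1..k. x i) = c] (mod n)}"

text \<open>Each prime divisor of \<open>n\<close> contributes its own factor \<open>(-1)^k\<close>, so the sign of the product
  formula for \<^const>\<open>phi\<close> is \<open>(-1)^(k * \<omega>(n))\<close>, where \<open>\<omega>(n)\<close> is the number of distinct prime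
  divisors of \<open>n\<close>. The formula is also found in print with the single sign \<open>(-1)^k\<close>. That
  version differs when \<open>k\<close> is odd and \<open>\<omega>(n)\<close> is even, and it is false: for \<open>k = 3\<close>,
  \<open>n = 15\<close>, \<open>c = 6\<close> its right-hand side is \<open>-4\<close>.\<close>

lemma sign_outside_product_fails:
  "\<not> (\<forall>k n c. k \<ge> 2 \<longrightarrow> n \<ge> 2 \<longrightarrow> rat_of_nat (phi k n c) =
    (-1) ^ k *
    (\<Prod>p\<in>prime_factors n.
       let \<alpha> = int (multiplicity p n) in
       rat_of_int p powi (\<alpha> * int k - \<alpha> - int k) *
       (rat_of_int p * (\<Sum>j | j \<in> {0..k} \<and> [int j = c] (mod p). of_nat (k choose j))
          + (2 - rat_of_int p) ^ k - 2 ^ k)))"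
  (is "\<not> (\<forall>k n c. _ \<longrightarrow> _ \<longrightarrow> _ = _ * (\<Prod>p\<in>_. ?F k n c p))")
proof
  assume *: "\<forall>k n c. k \<ge> 2 \<longrightarrow> n \<ge> 2 \<longrightarrow> rat_of_nat (phi k n c) = (-1) ^ k * (\<Prod>p\<in>prime_factors n. ?F k n c p)"
  have "prime_factorization (\<Prod>\<^sub># {#3, 5::int#}) = {#3, 5#}"
    by (rule prime_factorization_prod_mset_primes) auto
  then have pf: "prime_factorization (15::int) = {#3, 5#}" by simp
  have m: "multiplicity 3 (15::int) = 1" "multiplicity 5 (15::int) = 1"
    by (simp_all add: pf flip: count_prime_factorization_prime)
  have A: "{0..3::nat} = {0, 1, 2, 3}" by auto
  have s3: "{j. j \<in> {0..3} \<and> [int j = 6] (mod 3)} = {0, 3}"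
    unfolding A by (auto simp: cong_def)
  have s5: "{j. j \<in> {0..3} \<and> [int j = 6] (mod 5)} = {1}"
    unfolding A by (auto simp: cong_def)
  have F3: "?F 3 15 6 3 = -1"
    unfolding s3 m by (simp add: power_int_minus)
  have F5: "?F 3 15 6 5 = -4"
    unfolding s5 m by (simp add: power_int_minus)
  have "(\<Prod>p\<in>prime_factors 15. ?F 3 15 6 p) = ?F 3 15 6 3 * ?F 3 15 6 5"
    unfolding pf by simp
  also have "\<dots> = 4" unfolding F3 F5 by simp
  finally have "rat_of_nat (phi 3 15 6) = -4"
    using *[rule_format, of 3 15 6] by simp
  then show False using of_nat_0_le_iff[where 'a = rat, of "phi 3 15 6"] by simp
qed

end

theory Submission
  imports Defs
begin

text \<open>Splitting off the last coordinate gives \<open>\<phi>\<^sub>k\<^sub>+\<^sub>1(n, c) = \<Sum>a. \<phi>\<^sub>k(n, c - a)\<close>, the sum being over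
  the exceptional units \<open>a\<close>. For \<open>k \<ge> 1\<close> each factor of the claimed product depends on \<open>c\<close> only
  modulo \<open>p\<close>, and \<open>a\<close> is an exceptional unit iff \<open>a \<noteq> 0, 1\<close> modulo every prime \<open>p\<close> dividing \<open>n\<close>.
  So by the Chinese remainder theorem the sum over \<open>a\<close> of the product is the product over \<open>p\<close> of
  \<open>p\<^bsup>\<alpha> - 1\<^esup>\<close> times a sum over the residues modulo \<open>p\<close> other than 0 and 1, and the formula follows
  by induction on \<open>k\<close> from Pascal's rule. The induction starts at \<open>k = 1\<close>, because the count for
  \<open>k = 0\<close> depends on \<open>c\<close> modulo \<open>n\<close>.\<close>

section \<open>Sums of periodic functions over residues\<close>

text \<open>Chinese remainder theorem: coprimality makes the map injective, and both sides have
  \<open>m * n\<close> elements, so it is onto as well.\<close>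

lemma bij_betw_mod_Times:
  fixes m n :: int
  assumes "m > 0" "n > 0" "coprime m n"
  shows "bij_betw (\<lambda>a. (a mod m, a mod n)) {0..<m * n} ({0..<m} \<times> {0..<n})"
proof -
  let ?f = "\<lambda>a. (a mod m, a mod n)"
  have inj: "inj_on ?f {0..<m * n}"
  proof (rule inj_onI)
    fix a b assume ab: "a \<in> {0..<m * n}" "b \<in> {0..<m * n}" "?f a = ?f b"
    then have "[a = b] (mod m * n)"
      using assms(3) by (intro coprime_cong_mult) (auto simp: cong_def)
    with ab show "a = b" by (simp add: cong_def)
  qed
  have "?f ` {0..<m * n} = {0..<m} \<times> {0..<n}"
  proof (rule card_subset_eq)
    have "card (?f ` {0..<m * n}) = card {0..<m * n}" by (rule card_image[OF inj])
    also have "\<dots> = card ({0..<m} \<times> {0..<n})"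
      using assms by (simp add: card_cartesian_product nat_mult_distrib)
    finally show "card (?f ` {0..<m * n}) = card ({0..<m} \<times> {0..<n})" .
  qed (use assms in auto)
  with inj show ?thesis by (simp add: bij_betw_def)
qed

lemma sum_mult_coprime_periodic:
  fixes m n :: int and f g :: "int \<Rightarrow> 'a::comm_semiring_0"
  assumes "m > 0" "n > 0" "coprime m n"
    and f: "\<And>a. f (a mod m) = f a" and g: "\<And>a. g (a mod n) = g a"
  shows "(\<Sum>a\<in>{0..<m * n}. f a * g a) = (\<Sum>a\<in>{0..<m}. f a) * (\<Sum>a\<in>{0..<n}. g a)"
proof -
  have "(\<Sum>a\<in>{0..<m}. f a) * (\<Sum>a\<in>{0..<n}. g a) = (\<Sum>(a, b)\<in>{0..<m} \<times> {0..<n}. f a * g b)"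
    by (simp add: sum_product sum.cartesian_product)
  also have "\<dots> = (\<Sum>a\<in>{0..<m * n}. f (a mod m) * g (a mod n))"
    by (subst sum.reindex_bij_betw[OF bij_betw_mod_Times[OF assms(1-3)], symmetric]) simp
  finally show ?thesis by (simp add: f g)
qed

text \<open>Induction on \<open>P\<close>: the modulus of the new index is coprime to the product of
  the others, so the two-modulus case splits off one factor.\<close>

lemma sum_prod_coprime_periodic:
  fixes q :: "'i \<Rightarrow> int" and h :: "'i \<Rightarrow> int \<Rightarrow> 'a::comm_semiring_1"
  assumes "finite P" "\<And>p. p \<in> P \<Longrightarrow> q p > 0"
    and "\<And>p r. p \<in> P \<Longrightarrow> r \<in> P \<Longrightarrow> p \<noteq> r \<Longrightarrow> coprime (q p) (q r)"
    and "\<And>p a. p \<in> P \<Longrightarrow> h p (a mod q p) = h p a"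
  shows "(\<Sum>a\<in>{0..<\<Prod>p\<in>P. q p}. \<Prod>p\<in>P. h p a) = (\<Prod>p\<in>P. \<Sum>a\<in>{0..<q p}. h p a)"
  using assms
proof (induction P rule: finite_induct)
  case empty
  have "{0..<1::int} = {0}" by auto
  then show ?case by simp
next
  case (insert r P)
  \<comment> \<open>Each \<open>q p\<close> divides the full product, so reducing modulo the product
    does not change the residue modulo \<open>q p\<close>.\<close>
  have per: "(\<Prod>p\<in>P. h p (a mod (\<Prod>p\<in>P. q p))) = (\<Prod>p\<in>P. h p a)" for a
  proof (rule prod.cong)
    fix p assume p: "p \<in> P"
    then have "q p dvd (\<Prod>p\<in>P. q p)" using insert.hyps by (simp add: dvd_prodI)
    then have "a mod (\<Prod>p\<in>P. q p) mod q p = a mod q p" by (rule mod_mod_cancel)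
    then show "h p (a mod (\<Prod>p\<in>P. q p)) = h p a" using insert.prems(3) p by (metis insertI2)
  qed simp
  have cop: "coprime (q r) (\<Prod>p\<in>P. q p)"
    using insert.prems(2) insert.hyps by (intro prod_coprime_right) auto
  have "(\<Sum>a\<in>{0..<\<Prod>p\<in>insert r P. q p}. \<Prod>p\<in>insert r P. h p a) =
      (\<Sum>a\<in>{0..<q r * (\<Prod>p\<in>P. q p)}. h r a * (\<Prod>p\<in>P. h p a))"
    using insert.hyps by simp
  also have "\<dots> = (\<Sum>a\<in>{0..<q r}. h r a) * (\<Sum>a\<in>{0..<\<Prod>p\<in>P. q p}. \<Prod>p\<in>P. h p a)"
    using insert.prems by (intro sum_mult_coprime_periodic cop per) (auto intro: prod_pos)
  finally show ?case using insert by simp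
qed

lemma sum_periodic_mult:
  fixes p :: int and h :: "int \<Rightarrow> 'a::comm_semiring_1"
  assumes "p > 0" and h: "\<And>a. h (a mod p) = h a"
  shows "(\<Sum>a\<in>{0..<p * int m}. h a) = of_nat m * (\<Sum>a\<in>{0..<p}. h a)"
proof (induction m)
  case (Suc m)
  have "{0..<p * int (Suc m)} = {0..<p * int m} \<union> {p * int m..<p * int m + p}"
    using assms(1) zero_le_mult_iff[of p "int m"] by (simp add: ring_distribs ivl_disj_un add.commute)
  then have "(\<Sum>a\<in>{0..<p * int (Suc m)}. h a) =
      (\<Sum>a\<in>{0..<p * int m}. h a) + (\<Sum>a\<in>{p * int m..<p * int m + p}. h a)"
    by (simp only:) (rule sum.union_disjoint; auto)
  also have "(\<Sum>a\<in>{p * int m..<p * int m + p}. h a) = (\<Sum>a\<in>{0..<p}. h a)"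
  proof (rule sum.reindex_bij_witness[of _ "\<lambda>a. a + p * int m" "\<lambda>a. a - p * int m"])
    fix a
    have "(a - p * int m) mod p = a mod p" 
      by (metis diff_add_cancel mod_mult_self2)
    then show "h (a - p * int m) = h a" by (metis h)
  qed auto
  finally show ?case using Suc by (simp add: algebra_simps)
qed simp

section \<open>Recursion in the number of summands\<close>

lemma finite_exc_units_mod: "finite (exc_units_mod n)"
  by (rule finite_subset[of _ "{0..n - 1}"]) (auto simp: exc_units_mod_def residue_ring_def)

lemma phi_Suc:
  "phi (Suc k) n c = (\<Sum>a\<in>exc_units_mod n. phi k n (c - a))"
proof -
  let ?E = "exc_units_mod n"
  let ?A = "\<lambda>k c. {x \<in> {1..k} \<rightarrow>\<^sub>E ?E. [(\<Sum>i=1..k. x i) = c] (mod n)}"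
  have fin: "finite (?A k c)" for k :: nat and c
    by (rule finite_subset[of _ "{1..k} \<rightarrow>\<^sub>E ?E"])
      (auto intro: finite_PiE finite_exc_units_mod)
  have cong_iff: "[s + a = c] (mod n) \<longleftrightarrow> [s = c - a] (mod n)" for s a :: int
    by (simp add: cong_iff_dvd_diff algebra_simps)
  have sum_upd: "(\<Sum>i=1..k. (x(Suc k := a)) i) = (\<Sum>i=1..k. x i)" for x :: "nat \<Rightarrow> int" and a
    by (rule sum.cong) auto
  have "bij_betw (\<lambda>(a, x). x(Suc k := a)) (SIGMA a:?E. ?A k (c - a)) (?A (Suc k) c)"
  \<comment> \<open>The inverse resets position \<open>Suc k\<close> to \<open>undefined\<close>, as
    extensionality on \<open>{1..k}\<close> demands.\<close>
  proof (rule bij_betw_byWitness[where f' = "\<lambda>x. (x (Suc k), x(Suc k := undefined))"])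
    show "\<forall>p\<in>SIGMA a:?E. ?A k (c - a).
        (\<lambda>x. (x (Suc k), x(Suc k := undefined))) ((\<lambda>(a, x). x(Suc k := a)) p) = p"
      by (auto simp: PiE_def extensional_def fun_eq_iff)
    show "(\<lambda>(a, x). x(Suc k := a)) ` (SIGMA a:?E. ?A k (c - a)) \<subseteq> ?A (Suc k) c"
      by (auto simp: sum_upd cong_iff PiE_def extensional_def Pi_def simp del: fun_upd_apply)
        (auto split: if_splits)
    show "(\<lambda>x. (x (Suc k), x(Suc k := undefined))) ` ?A (Suc k) c \<subseteq> (SIGMA a:?E. ?A k (c - a))"
      by (auto simp: sum_upd cong_iff PiE_def extensional_def Pi_def simp del: fun_upd_apply)
        (auto split: if_splits)
  qed auto
  then have "card (?A (Suc k) c) = card (SIGMA a:?E. ?A k (c - a))"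
    by (simp add: bij_betw_same_card)
  also have "\<dots> = (\<Sum>a\<in>?E. card (?A k (c - a)))"
    using finite_exc_units_mod fin by (intro card_SigmaI) auto
  finally show ?thesis by (simp add: phi_def)
qed

section \<open>Binomial coefficients along a residue class\<close>

definition binomial_residue_sum :: "nat \<Rightarrow> int \<Rightarrow> int \<Rightarrow> rat" where
  "binomial_residue_sum k p c = (\<Sum>j | j \<in> {0..k} \<and> [int j = c] (mod p). of_nat (k choose j))"

lemma binomial_residue_sum_alt:
  "binomial_residue_sum k p c = (\<Sum>j\<le>k. of_bool ([int j = c] (mod p)) * of_nat (k choose j))"
  unfolding binomial_residue_sum_def
  by (rule sum.mono_neutral_cong_left) auto

lemma binomial_residue_sum_mod: "binomial_residue_sum k p (c mod p) = binomial_residue_sum k p c"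
  by (simp add: binomial_residue_sum_def cong_def)

text \<open>Pascal's rule; lowering the index by one in one of the two terms moves the residue class
  from \<open>c\<close> to \<open>c - 1\<close>.\<close>

lemma binomial_residue_sum_Suc:
  "binomial_residue_sum (Suc k) p c = binomial_residue_sum k p c + binomial_residue_sum k p (c - 1)"
proof -
  let ?b = "\<lambda>j c. of_bool ([int j = c] (mod p)) :: rat"
  have sh: "?b (Suc j) c = ?b j (c - 1)" for j
    by (simp add: cong_iff_dvd_diff algebra_simps)
  have "binomial_residue_sum (Suc k) p c =
      ?b 0 c + (\<Sum>j\<le>k. ?b (Suc j) c * of_nat (Suc k choose Suc j))"
    unfolding binomial_residue_sum_alt by (subst sum.atMost_Suc_shift) simp
  also have "\<dots> = (?b 0 c + (\<Sum>j\<le>k. ?b (Suc j) c * of_nat (k choose Suc j)))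
      + binomial_residue_sum k p (c - 1)"
    unfolding binomial_residue_sum_alt sh by (simp add: sum.distrib algebra_simps)
  also have "?b 0 c + (\<Sum>j\<le>k. ?b (Suc j) c * of_nat (k choose Suc j)) =
      (\<Sum>j\<le>Suc k. ?b j c * of_nat (k choose j))"
    by (subst sum.atMost_Suc_shift) simp
  also have "\<dots> = binomial_residue_sum k p c"
    unfolding binomial_residue_sum_alt by simp
  finally show ?thesis .
qed

text \<open>Every \<open>j\<close> lies in exactly one of the classes \<open>c - b\<close>, so the
  sum collects the whole row of Pascal's triangle.\<close>

lemma sum_binomial_residue_sum:
  assumes "p > 0"
  shows "(\<Sum>b\<in>{0..<p}. binomial_residue_sum k p (c - b)) = 2 ^ k"
proof -
  have "(\<Sum>b\<in>{0..<p}. of_bool ([int j = c - b] (mod p))) = (1::rat)" for j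
  proof -
    have "[int j = c - b] (mod p) \<longleftrightarrow> b = (c - int j) mod p" if "b \<in> {0..<p}" for b
    proof -
      have "[int j = c - b] (mod p) \<longleftrightarrow> [b = c - int j] (mod p)"
        by (simp add: cong_iff_dvd_diff algebra_simps)
      then show ?thesis using that by (simp add: cong_def)
    qed
    then have "(\<Sum>b\<in>{0..<p}. of_bool ([int j = c - b] (mod p))) =
        (\<Sum>b\<in>{0..<p}. if b = (c - int j) mod p then 1 else (0::rat))"
      by (intro sum.cong) auto
    then show ?thesis using assms by simp
  qed
  then have "(\<Sum>b\<in>{0..<p}. binomial_residue_sum k p (c - b)) = (\<Sum>j\<le>k. of_nat (k choose j))"
    unfolding binomial_residue_sum_alt
    by (subst sum.swap) (simp flip: sum_distrib_right)
  also have "\<dots> = of_nat (\<Sum>j\<le>k. k choose j)" by simp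
  finally show ?thesis by (simp only: choose_row_sum) simp
qed

section \<open>Contribution of a single prime power\<close>

text \<open>For prime \<open>p\<close> and positive \<open>k\<close> and \<open>\<alpha>\<close>
  this is the count for the modulus \<open>p\<close> to the power \<open>\<alpha>\<close>. The
  exponent equals \<open>(\<alpha> - 1) * (k - 1) - 1\<close>, which can be -1, hence
  \<open>powi\<close>.\<close>

definition local_factor :: "nat \<Rightarrow> int \<Rightarrow> int \<Rightarrow> int \<Rightarrow> rat" where
  "local_factor k p \<alpha> c = (-1) ^ k * (of_int p powi (\<alpha> * int k - \<alpha> - int k) *
     (of_int p * binomial_residue_sum k p c + (2 - of_int p) ^ k - 2 ^ k))"

lemma local_factor_mod: "local_factor k p \<alpha> (c mod p) = local_factor k p \<alpha> c"
  by (simp add: local_factor_def binomial_residue_sum_mod)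

text \<open>At \<open>k = 1\<close> the exponent is -1 whatever \<open>\<alpha>\<close> is, and the
  bracket is \<open>p\<close> times the binomial sum minus \<open>p\<close>.\<close>

lemma local_factor_1:
  assumes "p > 1"
  shows "local_factor 1 p \<alpha> c = of_bool (c mod p \<noteq> 0 \<and> c mod p \<noteq> 1)"
proof -
  have "local_factor 1 p \<alpha> c = 1 - of_bool ([0 = c] (mod p)) - of_bool ([1 = c] (mod p))"
    using assms unfolding local_factor_def binomial_residue_sum_alt
    by (simp add: power_int_minus field_simps)
  then show ?thesis using assms by (auto simp: cong_def)
qed

text \<open>The local form of the recursion for \<open>phi\<close>. The exponent
  \<open>\<beta>\<close> is arbitrary because the factor for \<open>k = 1\<close> does not depend on
  it.\<close>

lemma sum_local_factor:
  assumes p: "p > 1" and "\<alpha> \<ge> 1"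
  shows "(\<Sum>a\<in>{0..<p ^ \<alpha>}. local_factor 1 p \<beta> a * local_factor k p (int \<alpha>) (c - a)) =
    local_factor (Suc k) p (int \<alpha>) c"
proof -
  define G where "G k c = of_int p * binomial_residue_sum k p c + (2 - of_int p) ^ k - 2 ^ k" for k c
  let ?h = "\<lambda>a. local_factor 1 p \<beta> a * local_factor k p (int \<alpha>) (c - a)"
  let ?C = "(-1) ^ k * of_int p powi (int \<alpha> * int k - int \<alpha> - int k) :: rat"
  have lf: "local_factor k p (int \<alpha>) c = ?C * G k c" for c
    by (simp add: local_factor_def G_def)
  have split: "{0..<p} = insert 0 (insert 1 {2..<p})" using p by auto
  \<comment> \<open>Over a full period the binomial sums add up to \<open>2 ^ k\<close>, which
    cancels the \<open>p\<close> copies of \<open>- 2 ^ k\<close>.\<close>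
  have "(\<Sum>b\<in>{0..<p}. G k (c - b)) = of_int p * (2 - of_int p) ^ k"
    using p by (simp add: G_def sum.distrib sum_subtractf sum_binomial_residue_sum algebra_simps
        flip: sum_distrib_left)
  then have "(\<Sum>b\<in>{2..<p}. G k (c - b)) = of_int p * (2 - of_int p) ^ k - G k c - G k (c - 1)"
    unfolding split by (simp add: algebra_simps)
  \<comment> \<open>Pascal's rule merges the two binomial sums, and
    \<open>(p - 2) * (2 - p) ^ k = - (2 - p) ^ Suc k\<close>. This minus sign is the source of the
    alternating sign.\<close>
  also have "\<dots> = - G (Suc k) c"
    by (simp add: G_def binomial_residue_sum_Suc algebra_simps)
  finally have sumG: "(\<Sum>b\<in>{2..<p}. G k (c - b)) = - G (Suc k) c" .
  have "local_factor 1 p \<beta> 0 = 0" "local_factor 1 p \<beta> 1 = 0"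
    using p by (simp_all add: local_factor_1 del: One_nat_def)
  then have "(\<Sum>b\<in>{0..<p}. ?h b) = (\<Sum>b\<in>{2..<p}. ?h b)"
    unfolding split by (simp del: One_nat_def)
  also have "\<dots> = (\<Sum>b\<in>{2..<p}. ?C * G k (c - b))"
    by (rule sum.cong) (use p in \<open>simp_all only: lf local_factor_1, auto\<close>)
  also have "\<dots> = - ?C * G (Suc k) c"
    by (simp only: sumG mult_minus_right mult_minus_left flip: sum_distrib_left)
  finally have sum_p: "(\<Sum>b\<in>{0..<p}. ?h b) = - ?C * G (Suc k) c" .
  have per: "?h (a mod p) = ?h a" for a
    by (metis local_factor_mod mod_diff_right_eq)
  \<comment> \<open>The range of summation splits into \<open>p ^ (\<alpha> - 1)\<close> full
    periods of length \<open>p\<close>.\<close>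
  have "p ^ \<alpha> = p * int (nat p ^ (\<alpha> - 1))"
    using assms by (cases \<alpha>) auto
  then have "(\<Sum>a\<in>{0..<p ^ \<alpha>}. ?h a) = of_nat (nat p ^ (\<alpha> - 1)) * (\<Sum>b\<in>{0..<p}. ?h b)"
    using sum_periodic_mult[where h = ?h, OF _ per] p by (simp only:)
  also have "of_nat (nat p ^ (\<alpha> - 1)) = (of_int p powi (int \<alpha> - 1) :: rat)"
    using assms by (cases \<alpha>) (auto simp: of_nat_nat)
  also note sum_p
  also have "of_int p powi (int \<alpha> - 1) * (- ?C * G (Suc k) c) =
      (-1) ^ Suc k * ((of_int p powi (int \<alpha> - 1) * of_int p powi (int \<alpha> * int k - int \<alpha> - int k))
        * G (Suc k) c)"
    by simp
  also have "of_int p powi (int \<alpha> - 1) * of_int p powi (int \<alpha> * int k - int \<alpha> - int k) =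
      (of_int p powi (int \<alpha> * int (Suc k) - int \<alpha> - int (Suc k)) :: rat)"
    using p by (subst power_int_add[symmetric]) (auto simp: algebra_simps)
  finally show ?thesis by (simp add: local_factor_def G_def)
qed

section \<open>Exceptional units through residues modulo primes\<close>

lemma coprime_iff_no_prime_factor_dvd:
  fixes a n :: int
  assumes "n \<noteq> 0"
  shows "coprime a n \<longleftrightarrow> (\<forall>p\<in>prime_factors n. \<not> p dvd a)"
proof
  assume "coprime a n"
  then show "\<forall>p\<in>prime_factors n. \<not> p dvd a"
    by (metis coprime_common_divisor in_prime_factors_iff not_prime_unit)
next
  assume *: "\<forall>p\<in>prime_factors n. \<not> p dvd a"
  show "coprime a n"
  proof (rule ccontr)
    assume "\<not> coprime a n"
    then have "\<not> is_unit (gcd a n)" "gcd a n \<noteq> 0" using assms by (auto simp: is_unit_gcd_iff coprime_iff_gcd_eq_1)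
    then obtain p where "prime p" "p dvd gcd a n" using prime_divisor_exists by blast
    with * assms show False by (auto simp: in_prime_factors_iff)
  qed
qed

lemma exc_units_mod_iff:
  assumes "n \<ge> 2"
  shows "a \<in> exc_units_mod n \<longleftrightarrow>
    a \<in> {0..<n} \<and> (\<forall>p\<in>prime_factors n. a mod p \<noteq> 0 \<and> a mod p \<noteq> 1)"
proof -
  have "p dvd a - 1 \<longleftrightarrow> a mod p = 1" if "p \<in> prime_factors n" for p
  proof -
    have "p > 1" using that by (auto simp: in_prime_factors_iff prime_gt_1_int)
    then show ?thesis by (simp add: mod_eq_dvd_iff[symmetric])
  qed
  moreover have "a \<in> carrier (residue_ring n) \<longleftrightarrow> a \<in> {0..<n}"
    by (auto simp: residue_ring_def)
  ultimately show ?thesis using assms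
    by (auto simp: exc_units_mod_def coprime_iff_no_prime_factor_dvd dvd_eq_mod_eq_0
        simp flip: coprime_iff_gcd_eq_1)
qed

section \<open>Assembling the product over the primes\<close>

lemma phi_eq_prod_local_factor:
  assumes "k \<ge> 1" and n: "n \<ge> 2"
  shows "rat_of_nat (phi k n c) = (\<Prod>p\<in>prime_factors n. local_factor k p (int (multiplicity p n)) c)"
  using assms(1)
proof (induction k arbitrary: c rule: nat_induct_at_least)
  case base
  have 1: "p > 1" if "p \<in> prime_factors n" for p
    using that by (auto simp: in_prime_factors_iff prime_gt_1_int)
  have c_mod: "c mod n mod p = c mod p" if "p \<in> prime_factors n" for p
    using that by (auto simp: in_prime_factors_iff mod_mod_cancel)
  \<comment> \<open>Only the empty tuple is counted here; one step of the recursion then forces the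
    single coordinate to be the representative \<open>c mod n\<close>.\<close>
  have phi0: "phi 0 n d = of_bool ([0 = d] (mod n))" for d
    by (simp add: phi_def)
  have "phi 1 n c = (\<Sum>a\<in>exc_units_mod n. of_bool ([0 = c - a] (mod n)))"
    by (simp add: phi_Suc phi0)
  also have "\<dots> = (\<Sum>a\<in>exc_units_mod n. if a = c mod n then 1 else 0)"
  proof (rule sum.cong)
    fix a assume "a \<in> exc_units_mod n"
    then have "a mod n = a" using exc_units_mod_iff[OF n, of a] by simp
    moreover have "[0 = c - a] (mod n) \<longleftrightarrow> [a = c] (mod n)"
      by (simp add: cong_iff_dvd_diff dvd_diff_commute)
    ultimately show "of_bool ([0 = c - a] (mod n)) = (if a = c mod n then 1 else 0)"
      by (auto simp: cong_def)
  qed simp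
  also have "\<dots> = of_bool (c mod n \<in> exc_units_mod n)" by (simp add: finite_exc_units_mod)
  also have "\<dots> = of_bool (\<forall>p\<in>prime_factors n. c mod p \<noteq> 0 \<and> c mod p \<noteq> 1)"
    using n by (simp add: exc_units_mod_iff c_mod)
  finally show ?case by (simp add: local_factor_1 1 del: One_nat_def)
next
  case (Suc k)
  let ?\<alpha> = "\<lambda>p. int (multiplicity p n)"
  let ?h = "\<lambda>p a. local_factor 1 p (?\<alpha> p) a * local_factor k p (?\<alpha> p) (c - a)"
  have pr: "prime p" "p > 1" "multiplicity p n \<ge> 1" if "p \<in> prime_factors n" for p
    using that n prime_multiplicity_gt_zero_iff[of p n]
    by (auto simp: in_prime_factors_iff prime_gt_1_int)
  have n_eq: "n = (\<Prod>p\<in>prime_factors n. p ^ multiplicity p n)"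
    using n prod_prime_factors[of n] by simp
  \<comment> \<open>For \<open>k = 1\<close> the local factors are indicators, so their product can
    serve as a weight that extends the sum over exceptional units to all of
    \<open>{0..<n}\<close>.\<close>
  have ind: "of_bool (a \<in> exc_units_mod n) = (\<Prod>p\<in>prime_factors n. local_factor 1 p (?\<alpha> p) a)"
    if "a \<in> {0..<n}" for a
    using that by (simp add: exc_units_mod_iff[OF n] local_factor_1 pr(2) del: One_nat_def)
  \<comment> \<open>A function of period \<open>p\<close> also has the period
    \<open>p ^ multiplicity p n\<close>; these larger periods multiply to \<open>n\<close>.\<close>
  have per: "?h p (a mod p ^ multiplicity p n) = ?h p a" if "p \<in> prime_factors n" for p a
  proof -
    have "p dvd p ^ multiplicity p n" using pr[OF that] by (simp add: dvd_power)
    then have m: "a mod p ^ multiplicity p n mod p = a mod p" by (rule mod_mod_cancel)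
    then have "(c - a mod p ^ multiplicity p n) mod p = (c - a) mod p"
      by (metis mod_diff_right_eq)
    with m show ?thesis by (metis local_factor_mod)
  qed
  have "rat_of_nat (phi (Suc k) n c) = (\<Sum>a\<in>exc_units_mod n. rat_of_nat (phi k n (c - a)))"
    by (simp add: phi_Suc)
  also have "\<dots> = (\<Sum>a\<in>{0..<n}. of_bool (a \<in> exc_units_mod n) * rat_of_nat (phi k n (c - a)))"
    using exc_units_mod_iff[OF n] by (intro sum.mono_neutral_cong_left) auto
  also have "\<dots> = (\<Sum>a\<in>{0..<n}. \<Prod>p\<in>prime_factors n. ?h p a)"
    by (rule sum.cong) (simp_all only: ind Suc.IH prod.distrib)
  also have "\<dots> = (\<Sum>a\<in>{0..<\<Prod>p\<in>prime_factors n. p ^ multiplicity p n}. \<Prod>p\<in>prime_factors n. ?h p a)"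
    using n_eq by simp
  also have "\<dots> = (\<Prod>p\<in>prime_factors n. \<Sum>a\<in>{0..<p ^ multiplicity p n}. ?h p a)"
  proof (rule sum_prod_coprime_periodic)
    fix p assume "p \<in> prime_factors n"
    then show "p ^ multiplicity p n > 0" using pr(2)[of p] by simp
  next
    fix p r assume "p \<in> prime_factors n" "r \<in> prime_factors n" "p \<noteq> r"
    then show "coprime (p ^ multiplicity p n) (r ^ multiplicity r n)"
      using pr(1) by (simp add: primes_coprime)
  qed (use per in auto)
  also have "\<dots> = (\<Prod>p\<in>prime_factors n. local_factor (Suc k) p (?\<alpha> p) c)"
    using pr by (intro prod.cong sum_local_factor) auto
  finally show ?case .
qed

theorem theorem1p1:
  fixes k :: nat and n c :: int
  assumes "k \<ge> 2" and "n \<ge> 2"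
  shows "rat_of_nat (phi k n c) =
    (-1) ^ (k * card (prime_factors n)) *
    (\<Prod>p\<in>prime_factors n.
       let \<alpha> = int (multiplicity p n) in
       rat_of_int p powi (\<alpha> * int k - \<alpha> - int k) *
       (rat_of_int p * (\<Sum>j | j \<in> {0..k} \<and> [int j = c] (mod p). of_nat (k choose j))
          + (2 - rat_of_int p) ^ k - 2 ^ k))"
  \<comment> \<open>Each local factor carries its own \<open>(-1) ^ k\<close>; collecting them gives
    one such sign per prime factor of \<open>n\<close>.\<close>
  using assms
  by (simp add: phi_eq_prod_local_factor local_factor_def binomial_residue_sum_def prod.distrib
      power_mult Let_def)

end
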